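(* Let $I=\langle g_1,\dots,g_m\rangle$ be an ideal of $\mathbb{R}[x]=\mathbb{R}[x_1,\dots,x_n]$ with $V_{\mathbb{R}}(I)\neq\emptyset$, and let $t\ge 1$ be an integer with $t\ge d$. Let $\mathrm{Opt}(I)$ be the set of all $\mathsf{y}\in K_t^{\mathbb{R}}$ that are optimal solutions of the optimization problem $$\min\ \operatorname{rank}(M_t(\mathsf{y}))\quad\text{subject to}\quad \mathsf{y}\in K_t^{\mathbb{R}}.$$ Then the map $$V_{\mathbb{R}}(I)\to\mathrm{Opt}(I),\qquad v\mapsto \mathsf{y}^{\delta_v}_t$$ is a one-to-one correspondence (a bijection) between the real roots in $V_{\mathbb{R}}(I)$ and the optimal solutions of this problem; in particular $\operatorname{rank}(M_t(\mathsf{y}))=1$ for every optimal solution $\mathsf{y}$.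
   Context: $V_{\mathbb{R}}(I)\subseteq\mathbb{R}^n$ is the set of common real zeros of $I$. For $\alpha\in\mathbb{N}^n$ (with $0\in\mathbb{N}$), $|\alpha|=\sum_i\alpha_i$, and $\mathbb{N}^n_{s}=\{\alpha\in\mathbb{N}^n:|\alpha|\le s\}$. Put $d_j=\lceil\deg(g_j)/2\rceil$ and $d=\max_{j=1,\dots,m}d_j$. For $\mathsf{y}=(\mathsf{y}_\alpha)\in\mathbb{R}^{\mathbb{N}^n_{2t}}$, the truncated moment matrix of order $t$ is $M_t(\mathsf{y})=(\mathsf{y}_{\alpha+\beta})_{|\alpha|,|\beta|\le t}$. Writing $g_j=\sum_\alpha g_{j,\alpha}x^\alpha$, the localizing matrix $M_{t-d_j}(g_j\mathsf{y})$ is indexed by $\beta,\gamma\in\mathbb{N}^n_{t-d_j}$ and has $(\beta,\gamma)$ entry $\sum_\alpha g_{j,\alpha}\mathsf{y}_{\alpha+\beta+\gamma}$. For $t\ge d$, $$K_t^{\mathbb{R}}=\{\mathsf{y}\in\mathbb{R}^{\mathbb{N}^n_{2t}}:\ \mathsf{y}_0=1,\ M_t(\mathsf{y})\succeq 0,\ M_{t-d_j}(g_j\mathsf{y})=0,\ j=1,\dots,m\},$$ where $\succeq 0$ means positive semidefinite. For $v\in\mathbb{R}^n$, $\mathsf{y}^{\delta_v}_t=(v^\alpha)_{\alpha\in\mathbb{N}^n_{2t}}$ where $v^\alpha=\prod_i v_i^{\alpha_i}$. *)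

theory Defs
  imports "HOL-Analysis.Analysis" "HOL-Analysis.Finite_Function_Topology"
    "HOL-Library.Poly_Mapping" "HOL-Library.FuncSet"
begin

text \<open>
  The finite type \<open>'n\<close> indexes the variables: points of the \<open>n\<close>-dimensional space have type
  \<open>real ^ 'n\<close>, exponents have type \<open>'n \<Rightarrow>\<^sub>0 nat\<close>, and the ring operations of
  \<open>Poly_Mapping\<close> on \<open>('n \<Rightarrow>\<^sub>0 nat) \<Rightarrow>\<^sub>0 real\<close> are those of the polynomial ring.
\<close>

type_synonym 'n mono = "'n \<Rightarrow>\<^sub>0 nat"
type_synonym 'n rpoly = "'n mono \<Rightarrow>\<^sub>0 real"

definition mono_deg :: "'n::finite mono \<Rightarrow> nat" where
  "mono_deg \<alpha> = (\<Sum>i\<in>UNIV. Poly_Mapping.lookup \<alpha> i)"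

definition monos_upto :: "nat \<Rightarrow> 'n::finite mono set" where
  "monos_upto s = {\<alpha>. mono_deg \<alpha> \<le> s}"

lemma finite_monos_upto: "finite (monos_upto s :: 'n::finite mono set)"
proof -
  have "Poly_Mapping.lookup \<alpha> i \<le> s" if "\<alpha> \<in> monos_upto s" for \<alpha> :: "'n mono" and i
  proof -
    have "Poly_Mapping.lookup \<alpha> i \<le> (\<Sum>i\<in>UNIV. Poly_Mapping.lookup \<alpha> i)"
      by (rule member_le_sum) auto
    with that show ?thesis by (simp add: monos_upto_def mono_deg_def)
  qed
  then have "Poly_Mapping.lookup ` (monos_upto s :: 'n mono set) \<subseteq> UNIV \<rightarrow>\<^sub>E {..s}"
    by auto
  moreover have "finite ((UNIV :: 'n set) \<rightarrow>\<^sub>E {..s})"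
    by (rule finite_PiE) auto
  ultimately have "finite (Poly_Mapping.lookup ` (monos_upto s :: 'n mono set))"
    by (rule finite_subset)
  moreover have "inj_on Poly_Mapping.lookup (monos_upto s :: 'n mono set)"
    by (simp add: inj_on_def poly_mapping.lookup_inject)
  ultimately show ?thesis
    by (rule finite_imageD)
qed

definition mono_eval :: "real ^ 'n::finite \<Rightarrow> 'n mono \<Rightarrow> real" where
  "mono_eval v \<alpha> = (\<Prod>i\<in>UNIV. (v $ i) ^ Poly_Mapping.lookup \<alpha> i)"

definition poly_eval :: "'n::finite rpoly \<Rightarrow> real ^ 'n \<Rightarrow> real" where
  "poly_eval p v = (\<Sum>\<alpha>\<in>Poly_Mapping.keys p. Poly_Mapping.lookup p \<alpha> * mono_eval v \<alpha>)"

text \<open>Total degree, with the convention that the zero polynomial has degree \<open>0\<close>.\<close>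

definition total_deg :: "'n::finite rpoly \<Rightarrow> nat" where
  "total_deg p = Max (insert 0 (mono_deg ` Poly_Mapping.keys p))"

definition half_deg :: "'n::finite rpoly \<Rightarrow> nat" where
  "half_deg p = nat \<lceil>real (total_deg p) / 2\<rceil>"

text \<open>The inserted \<open>0\<close> only matters for an empty list of generators, \<open>m = 0\<close>.\<close>

definition max_half_deg :: "nat \<Rightarrow> (nat \<Rightarrow> 'n::finite rpoly) \<Rightarrow> nat" where
  "max_half_deg m g = Max (insert 0 ((\<lambda>j. half_deg (g j)) ` {1..m}))"

definition ideal_gen :: "nat \<Rightarrow> (nat \<Rightarrow> 'a::comm_ring_1) \<Rightarrow> 'a set" where
  "ideal_gen m g = {\<Sum>j=1..m. q j * g j | q. True}"

definition real_variety :: "'n::finite rpoly set \<Rightarrow> (real ^ 'n) set" where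
  "real_variety I = {v. \<forall>p\<in>I. poly_eval p v = 0}"

text \<open>
  A matrix with rows and columns indexed by a finite set \<open>A\<close> is a binary function restricted to
  \<open>A\<close>. Its columns are regarded as vectors by extending them by \<open>0\<close> outside \<open>A\<close>; \<^const>\<open>dim\<close>
  of a set of vectors is the dimension of its linear span.
\<close>

definition mat_column :: "'i set \<Rightarrow> ('i \<Rightarrow> 'i \<Rightarrow> real) \<Rightarrow> 'i \<Rightarrow> ('i \<Rightarrow>\<^sub>0 real)" where
  "mat_column A M b = Abs_poly_mapping (\<lambda>a. if a \<in> A then M a b else 0)"

definition mat_rank :: "'i set \<Rightarrow> ('i \<Rightarrow> 'i \<Rightarrow> real) \<Rightarrow> nat" where
  "mat_rank A M = dim (mat_column A M ` A)"

definition psd_mat :: "'i set \<Rightarrow> ('i \<Rightarrow> 'i \<Rightarrow> real) \<Rightarrow> bool" where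
  "psd_mat A M \<longleftrightarrow>
     (\<forall>a\<in>A. \<forall>b\<in>A. M a b = M b a) \<and>
     (\<forall>c. (\<Sum>a\<in>A. \<Sum>b\<in>A. c a * M a b * c b) \<ge> 0)"

definition moment_mat :: "('n::finite mono \<Rightarrow> real) \<Rightarrow> 'n mono \<Rightarrow> 'n mono \<Rightarrow> real" where
  "moment_mat y \<alpha> \<beta> = y (\<alpha> + \<beta>)"

definition moment_rank :: "nat \<Rightarrow> ('n::finite mono \<Rightarrow> real) \<Rightarrow> nat" where
  "moment_rank t y = mat_rank (monos_upto t) (moment_mat y)"

definition localizing_mat ::
    "'n::finite rpoly \<Rightarrow> ('n mono \<Rightarrow> real) \<Rightarrow> 'n mono \<Rightarrow> 'n mono \<Rightarrow> real" where
  "localizing_mat p y \<beta> \<gamma> =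
     (\<Sum>\<alpha>\<in>Poly_Mapping.keys p. Poly_Mapping.lookup p \<alpha> * y (\<alpha> + \<beta> + \<gamma>))"

text \<open>
  Truncated sequences are the extensional functions on \<open>monos_upto (2 * t)\<close>. For
  \<open>t \<ge> max_half_deg m g\<close>, the case of interest, the subtraction below is not truncated and
  only entries of \<open>y\<close> inside that index set occur.
\<close>

definition moment_feasible ::
    "nat \<Rightarrow> nat \<Rightarrow> (nat \<Rightarrow> 'n::finite rpoly) \<Rightarrow> ('n mono \<Rightarrow> real) set" where
  "moment_feasible t m g =
     {y \<in> monos_upto (2 * t) \<rightarrow>\<^sub>E UNIV.
        y 0 = 1 \<and>
        psd_mat (monos_upto t) (moment_mat y) \<and>
        (\<forall>j\<in>{1..m}. \<forall>\<beta>\<in>monos_upto (t - half_deg (g j)). \<forall>\<gamma>\<in>monos_upto (t - half_deg (g j)).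
           localizing_mat (g j) y \<beta> \<gamma> = 0)}"

definition rank_minimizers ::
    "nat \<Rightarrow> nat \<Rightarrow> (nat \<Rightarrow> 'n::finite rpoly) \<Rightarrow> ('n mono \<Rightarrow> real) set" where
  "rank_minimizers t m g =
     {y. is_arg_min (moment_rank t) (\<lambda>z. z \<in> moment_feasible t m g) y}"

definition dirac_moments :: "nat \<Rightarrow> real ^ 'n::finite \<Rightarrow> 'n mono \<Rightarrow> real" where
  "dirac_moments t v = restrict (mono_eval v) (monos_upto (2 * t))"

end

theory Submission
  imports Defs
begin

text \<open>
  Every feasible \<open>y\<close> has \<open>y 0 = 1\<close>, so \<open>M\<^sub>t(y)\<close> is nonzero and has rank at least \<open>1\<close>, and the
  moments of a real root are feasible of rank exactly \<open>1\<close>. As a real root exists, the minimum is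
  \<open>1\<close>, and the theorem says that the feasible \<open>y\<close> of rank \<open>1\<close> are the moment sequences of real
  roots.

  The point is that rank \<open>1\<close> makes \<open>y\<close> multiplicative. All columns of \<open>M\<^sub>t(y)\<close> are then multiples
  of the column indexed by \<open>0\<close>, and as the diagonal entry there is \<open>y 0 = 1\<close>, this forces
  \<open>y (\<alpha> + \<beta>) = y \<alpha> * y \<beta>\<close> whenever \<open>\<alpha>\<close> and \<open>\<beta>\<close> have degree at most \<open>t\<close>
  (\<open>mat_rank_eq_1_iff\<close>). Since \<open>t \<ge> 1\<close>, the values of \<open>y\<close> on the variables define a point \<open>v\<close>; a
  monomial of degree at most \<open>2 * t\<close> is a product of two of degree at most \<open>t\<close>, and those are
  products of variables, so \<open>y \<alpha> = v\<^sup>\<alpha>\<close> up to degree \<open>2 * t\<close> (\<open>rank_1_imp_dirac_moments\<close>). The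
  corner entry of the localizing matrix of \<open>g j\<close> now reads \<open>g j (v) = 0\<close>, because
  \<open>deg (g j) \<le> 2 * t\<close>; so \<open>v\<close> is a real root. Injectivity is clear, as \<open>v\<close> is read off from the
  moments of degree \<open>1\<close>.
\<close>

section \<open>Monomials\<close>

lemma mono_deg_add: "mono_deg (\<alpha> + \<beta>) = mono_deg \<alpha> + mono_deg \<beta>"
  by (simp add: mono_deg_def lookup_add sum.distrib)

lemma mono_deg_zero [simp]: "mono_deg 0 = 0"
  by (simp add: mono_deg_def)

lemma mono_deg_variable [simp]: "mono_deg (Poly_Mapping.single i (Suc 0)) = 1"
  by (simp add: mono_deg_def lookup_single when_def)

lemma mono_deg_eq_0_iff: "mono_deg \<alpha> = 0 \<longleftrightarrow> \<alpha> = 0"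
  by (auto simp: mono_deg_def poly_mapping_eq_iff fun_eq_iff)

lemma zero_in_monos_upto [simp]: "0 \<in> monos_upto s"
  by (simp add: monos_upto_def)

lemma mono_eval_zero [simp]: "mono_eval v 0 = 1"
  by (simp add: mono_eval_def)

lemma mono_eval_add: "mono_eval v (\<alpha> + \<beta>) = mono_eval v \<alpha> * mono_eval v \<beta>"
  by (simp add: mono_eval_def lookup_add power_add prod.distrib)

lemma mono_eval_variable [simp]: "mono_eval v (Poly_Mapping.single i (Suc 0)) = v $ i"
proof -
  have "mono_eval v (Poly_Mapping.single i (Suc 0)) = (\<Prod>j\<in>UNIV. if j = i then v $ j else 1)"
    unfolding mono_eval_def by (rule prod.cong) (auto simp: lookup_single when_def)
  then show ?thesis by simp
qed

lemma mono_factor_variable: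
  fixes \<alpha> :: "'n::finite mono"
  assumes "\<alpha> \<noteq> 0"
  obtains i \<beta> where "\<alpha> = \<beta> + Poly_Mapping.single i (Suc 0)"
proof -
  from assms obtain i where i: "Poly_Mapping.lookup \<alpha> i \<noteq> 0"
    by (auto simp: poly_mapping_eq_iff fun_eq_iff)
  have "\<alpha> = (\<alpha> - Poly_Mapping.single i (Suc 0)) + Poly_Mapping.single i (Suc 0)"
    by (rule poly_mapping_eqI) (use i in \<open>auto simp: lookup_add lookup_minus lookup_single when_def\<close>)
  then show thesis by (rule that)
qed

lemma mono_factor_degrees:
  fixes \<alpha> :: "'n::finite mono"
  assumes "mono_deg \<alpha> \<le> a + b"
  shows "\<exists>\<beta> \<gamma>. \<alpha> = \<beta> + \<gamma> \<and> mono_deg \<beta> \<le> a \<and> mono_deg \<gamma> \<le> b"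
  using assms
proof (induction b arbitrary: \<alpha>)
  case 0
  then show ?case by (intro exI[of _ \<alpha>] exI[of _ 0]) simp
next
  case (Suc b)
  show ?case
  proof (cases "\<alpha> = 0")
    case True
    then show ?thesis by (intro exI[of _ 0]) simp
  next
    case False
    then obtain i \<alpha>' where \<alpha>: "\<alpha> = \<alpha>' + Poly_Mapping.single i (Suc 0)"
      by (rule mono_factor_variable)
    with Suc.prems have "mono_deg \<alpha>' \<le> a + b"
      by (simp add: mono_deg_add)
    then obtain \<beta> \<gamma> where "\<alpha>' = \<beta> + \<gamma>" "mono_deg \<beta> \<le> a" "mono_deg \<gamma> \<le> b"
      using Suc.IH by blast
    then show ?thesis
      by (intro exI[of _ \<beta>] exI[of _ "\<gamma> + Poly_Mapping.single i (Suc 0)"])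
        (simp add: \<alpha> mono_deg_add add.assoc)
  qed
qed

section \<open>Real roots of an ideal and of its generators\<close>

lemma poly_eval_superset:
  assumes "finite A" and "Poly_Mapping.keys p \<subseteq> A"
  shows "poly_eval p v = (\<Sum>\<alpha>\<in>A. Poly_Mapping.lookup p \<alpha> * mono_eval v \<alpha>)"
  unfolding poly_eval_def
  by (rule sum.mono_neutral_left) (use assms in \<open>auto simp: in_keys_iff\<close>)

lemma poly_eval_zero [simp]: "poly_eval 0 v = 0"
  by (simp add: poly_eval_def)

lemma poly_eval_single: "poly_eval (Poly_Mapping.single \<alpha> c) v = c * mono_eval v \<alpha>"
  by (simp add: poly_eval_def)

lemma poly_eval_add: "poly_eval (p + q) v = poly_eval p v + poly_eval q v"
proof -
  let ?A = "Poly_Mapping.keys p \<union> Poly_Mapping.keys q"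
  have "poly_eval (p + q) v = (\<Sum>\<alpha>\<in>?A. Poly_Mapping.lookup (p + q) \<alpha> * mono_eval v \<alpha>)"
    by (rule poly_eval_superset) (simp_all add: keys_add)
  also have "\<dots> = (\<Sum>\<alpha>\<in>?A. Poly_Mapping.lookup p \<alpha> * mono_eval v \<alpha>) +
                  (\<Sum>\<alpha>\<in>?A. Poly_Mapping.lookup q \<alpha> * mono_eval v \<alpha>)"
    by (simp add: lookup_add algebra_simps sum.distrib)
  also have "\<dots> = poly_eval p v + poly_eval q v"
    by (simp add: poly_eval_superset[of ?A])
  finally show ?thesis .
qed

lemma rpoly_induct [case_names zero add_monomial]:
  fixes p :: "'n rpoly"
  assumes "P 0" and "\<And>\<alpha> c p. P p \<Longrightarrow> P (Poly_Mapping.single \<alpha> c + p)"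
  shows "P p"
proof (induction p rule: update_induct)
  case const
  show ?case by fact
next
  case (update p \<alpha> c)
  have "Poly_Mapping.update \<alpha> c p = Poly_Mapping.single \<alpha> c + p"
    by (rule poly_mapping_eqI)
      (use update in \<open>auto simp: lookup_update lookup_add lookup_single when_def in_keys_iff\<close>)
  with assms(2)[OF update(3)] show ?case by simp
qed

lemma poly_eval_mult: "poly_eval (p * q) v = poly_eval p v * poly_eval q v"
proof (induction p rule: rpoly_induct)
  case zero
  show ?case by simp
next
  case (add_monomial \<alpha> c p)
  have "poly_eval (Poly_Mapping.single \<alpha> c * q) v = c * mono_eval v \<alpha> * poly_eval q v"
  proof (induction q rule: rpoly_induct)
    case zero
    show ?case by simp
  next
    case (add_monomial \<beta> d q)
    then show ?case
      by (simp add: distrib_left poly_eval_add mult_single poly_eval_single mono_eval_add)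
  qed
  with add_monomial show ?case
    by (simp add: distrib_right poly_eval_add poly_eval_single)
qed

lemma poly_eval_sum: "poly_eval (\<Sum>j\<in>J. f j) v = (\<Sum>j\<in>J. poly_eval (f j) v)"
  by (induction J rule: infinite_finite_induct) (simp_all add: poly_eval_add)

lemma generator_in_ideal_gen:
  assumes "j \<in> {1..m}"
  shows "g j \<in> ideal_gen m g"
proof -
  have "(\<Sum>k=1..m. (if k = j then 1 else 0) * g k) = (\<Sum>k=1..m. if k = j then g k else 0)"
    by (rule sum.cong) auto
  also have "\<dots> = g j"
    using assms by simp
  finally have "g j = (\<Sum>k=1..m. (if k = j then 1 else 0) * g k)"
    by (rule sym)
  then show ?thesis
    unfolding ideal_gen_def by (intro CollectI exI[of _ "\<lambda>k. if k = j then 1 else 0"] conjI TrueI)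
qed

lemma real_variety_ideal_gen:
  "real_variety (ideal_gen m g) = {v. \<forall>j\<in>{1..m}. poly_eval (g j) v = 0}"
proof (intro set_eqI iffI)
  fix v assume "v \<in> real_variety (ideal_gen m g)"
  then show "v \<in> {v. \<forall>j\<in>{1..m}. poly_eval (g j) v = 0}"
    using generator_in_ideal_gen[of _ m g] by (auto simp: real_variety_def)
next
  fix v assume "v \<in> {v. \<forall>j\<in>{1..m}. poly_eval (g j) v = 0}"
  then show "v \<in> real_variety (ideal_gen m g)"
    by (auto simp: real_variety_def ideal_gen_def poly_eval_sum poly_eval_mult)
qed

section \<open>Matrices of rank one\<close>

lemma dim_ge_1_of_nonzero:
  fixes w :: "'a::real_vector"
  assumes "finite V" and "w \<in> V" and "w \<noteq> 0"
  shows "1 \<le> dim V"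
proof -
  obtain B where B: "B \<subseteq> V" "V \<subseteq> span B" "card B = dim V"
    by (rule real_vector.basis_exists[of V])
  have "B \<noteq> {}"
    using B(2) assms(2,3) by auto
  moreover have "finite B"
    using B(1) assms(1) by (rule finite_subset)
  ultimately show ?thesis
    using B(3) by (metis Suc_leI card_gt_0_iff One_nat_def)
qed

lemma dim_eq_1_iff_of_nonzero:
  fixes w :: "'a::real_vector"
  assumes "w \<in> V" and "w \<noteq> 0"
  shows "dim V = 1 \<longleftrightarrow> (\<forall>x\<in>V. \<exists>k. x = k *\<^sub>R w)"
proof
  assume "dim V = 1"
  obtain B where B: "B \<subseteq> V" "V \<subseteq> span B" "card B = dim V"
    by (rule real_vector.basis_exists[of V])
  with \<open>dim V = 1\<close> obtain b where "B = {b}"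
    by (metis card_1_singletonE)
  with B(2) have multiple: "\<exists>k. x = k *\<^sub>R b" if "x \<in> V" for x
    using that by (auto simp: real_vector.span_singleton)
  obtain l where l: "w = l *\<^sub>R b"
    using multiple assms(1) by blast
  with assms(2) have "b = inverse l *\<^sub>R w"
    by auto
  with multiple show "\<forall>x\<in>V. \<exists>k. x = k *\<^sub>R w"
    by (metis scaleR_scaleR)
next
  assume "\<forall>x\<in>V. \<exists>k. x = k *\<^sub>R w"
  then have "V \<subseteq> span {w}"
    by (auto simp: real_vector.span_singleton)
  then show "dim V = 1"
    using assms by (intro real_vector.dim_unique[of "{w}"]) auto
qed

lemma lookup_mat_column:
  assumes "finite A"
  shows "Poly_Mapping.lookup (mat_column A M b) a = (if a \<in> A then M a b else 0)"
  using assms by (simp add: mat_column_def)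

lemma lookup_scaleR: "Poly_Mapping.lookup (k *\<^sub>R x) a = k *\<^sub>R Poly_Mapping.lookup x a"
proof -
  have "finite {a. k *\<^sub>R Poly_Mapping.lookup x a \<noteq> 0}"
    by (rule finite_subset[OF _ finite_lookup[of x]]) auto
  then show ?thesis
    by (simp add: scaleR_poly_mapping_def)
qed

context
  fixes A :: "'i set" and M :: "'i \<Rightarrow> 'i \<Rightarrow> real" and e :: 'i
  assumes finite: "finite A" and e: "e \<in> A" and diagonal: "M e e = 1"
begin

lemma mat_column_nonzero: "mat_column A M e \<noteq> 0"
  using lookup_mat_column[OF finite, of M e e] e diagonal by auto

lemma mat_rank_ge_1: "1 \<le> mat_rank A M"
  unfolding mat_rank_def
  using mat_column_nonzero finite e by (intro dim_ge_1_of_nonzero[of _ "mat_column A M e"]) auto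

text \<open>
  If column \<open>b\<close> is \<open>k\<close> times column \<open>e\<close>, then comparing the entries in row \<open>e\<close> gives \<open>k = M e b\<close>;
  so the matrix is the outer product of its row and its column through the entry \<open>1\<close>.
\<close>

lemma mat_rank_eq_1_iff:
  "mat_rank A M = 1 \<longleftrightarrow> (\<forall>a\<in>A. \<forall>b\<in>A. M a b = M a e * M e b)"
proof -
  have column_multiple_iff:
    "mat_column A M b = k *\<^sub>R mat_column A M e \<longleftrightarrow> (\<forall>a\<in>A. M a b = k * M a e)" for b k
    by (auto simp: poly_mapping_eq_iff fun_eq_iff lookup_scaleR lookup_mat_column[OF finite])
  have "mat_rank A M = 1 \<longleftrightarrow> (\<forall>b\<in>A. \<exists>k. mat_column A M b = k *\<^sub>R mat_column A M e)"
    unfolding mat_rank_def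
    using mat_column_nonzero e by (subst dim_eq_1_iff_of_nonzero[of "mat_column A M e"]) auto
  also have "\<dots> \<longleftrightarrow> (\<forall>b\<in>A. \<exists>k. \<forall>a\<in>A. M a b = k * M a e)"
    by (simp only: column_multiple_iff)
  also have "\<dots> \<longleftrightarrow> (\<forall>b\<in>A. \<forall>a\<in>A. M a b = M a e * M e b)"
  proof (rule ball_cong[OF refl])
    fix b
    show "(\<exists>k. \<forall>a\<in>A. M a b = k * M a e) \<longleftrightarrow> (\<forall>a\<in>A. M a b = M a e * M e b)"
      using e diagonal by (metis mult.commute mult.right_neutral)
  qed
  finally show ?thesis by blast
qed

end

section \<open>Moment sequences of rank one\<close>

lemma moment_rank_ge_1: "y 0 = 1 \<Longrightarrow> 1 \<le> moment_rank t y"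
  unfolding moment_rank_def
  by (rule mat_rank_ge_1[OF finite_monos_upto zero_in_monos_upto]) (simp add: moment_mat_def)

lemma moment_rank_eq_1_iff:
  assumes "y 0 = 1"
  shows "moment_rank t y = 1 \<longleftrightarrow>
    (\<forall>\<alpha>\<in>monos_upto t. \<forall>\<beta>\<in>monos_upto t. y (\<alpha> + \<beta>) = y \<alpha> * y \<beta>)"
  unfolding moment_rank_def
  by (subst mat_rank_eq_1_iff[OF finite_monos_upto zero_in_monos_upto])
    (simp_all add: moment_mat_def assms)

lemma dirac_moments_eq: "mono_deg \<alpha> \<le> 2 * t \<Longrightarrow> dirac_moments t v \<alpha> = mono_eval v \<alpha>"
  by (simp add: dirac_moments_def monos_upto_def)

lemma moment_rank_dirac_moments: "moment_rank t (dirac_moments t v) = 1"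
  by (subst moment_rank_eq_1_iff)
    (simp_all add: dirac_moments_eq monos_upto_def mono_deg_add mono_eval_add)

lemma rank_1_imp_dirac_moments:
  fixes y :: "'n::finite mono \<Rightarrow> real"
  assumes "t \<ge> 1" and y0: "y 0 = 1" and "moment_rank t y = 1"
    and extensional: "y \<in> monos_upto (2 * t) \<rightarrow>\<^sub>E UNIV"
  shows "y = dirac_moments t (\<chi> i. y (Poly_Mapping.single i (Suc 0)))"
proof -
  define v where "v = (\<chi> i. y (Poly_Mapping.single i (Suc 0)))"
  have mult: "y (\<alpha> + \<beta>) = y \<alpha> * y \<beta>" if "mono_deg \<alpha> \<le> t" "mono_deg \<beta> \<le> t" for \<alpha> \<beta>
    using moment_rank_eq_1_iff[of y t] y0 assms(3) that by (simp add: monos_upto_def)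
  have low: "y \<alpha> = mono_eval v \<alpha>" if "mono_deg \<alpha> \<le> t" for \<alpha>
    using that
  proof (induction "mono_deg \<alpha>" arbitrary: \<alpha>)
    case 0
    then have "\<alpha> = 0" by (metis mono_deg_eq_0_iff)
    then show ?case by (simp add: y0)
  next
    case (Suc k)
    then have "\<alpha> \<noteq> 0" by auto
    then obtain i \<beta> where \<alpha>: "\<alpha> = \<beta> + Poly_Mapping.single i (Suc 0)"
      by (rule mono_factor_variable)
    with Suc have "y \<beta> = mono_eval v \<beta>"
      by (simp add: mono_deg_add)
    then show ?case
      using Suc.prems \<open>t \<ge> 1\<close> unfolding \<alpha>
      by (subst mult) (simp_all add: mono_deg_add mono_eval_add v_def)
  qed
  have "y \<alpha> = dirac_moments t v \<alpha>" for \<alpha>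
  proof (cases "mono_deg \<alpha> \<le> t + t")
    case True
    then obtain \<beta> \<gamma> where "\<alpha> = \<beta> + \<gamma>" "mono_deg \<beta> \<le> t" "mono_deg \<gamma> \<le> t"
      using mono_factor_degrees by blast
    then show ?thesis
      by (simp add: mult low dirac_moments_eq mono_deg_add mono_eval_add)
  next
    case False
    then show ?thesis
      using PiE_arb[OF extensional, of \<alpha>] by (simp add: dirac_moments_def monos_upto_def)
  qed
  then show ?thesis
    unfolding v_def by blast
qed

lemma inj_dirac_moments:
  assumes "t \<ge> 1"
  shows "inj (dirac_moments t :: real ^ 'n::finite \<Rightarrow> _)"
proof (rule injI)
  fix v w :: "real ^ 'n"
  assume eq: "dirac_moments t v = dirac_moments t w"
  have "v $ i = dirac_moments t v (Poly_Mapping.single i (Suc 0))" for v :: "real ^ 'n" and i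
    using assms by (subst dirac_moments_eq) simp_all
  with eq show "v = w"
    by (metis vec_eq_iff)
qed

section \<open>Feasibility of the moments of a point\<close>

lemma mono_deg_le_half_deg:
  assumes "\<alpha> \<in> Poly_Mapping.keys p"
  shows "mono_deg \<alpha> \<le> 2 * half_deg p"
proof -
  have "mono_deg \<alpha> \<le> total_deg p"
    unfolding total_deg_def using assms by (intro Max_ge) auto
  also have "total_deg p \<le> 2 * half_deg p"
    unfolding half_deg_def by linarith
  finally show ?thesis .
qed

lemma localizing_mat_dirac_moments:
  assumes "half_deg p \<le> t"
    and "\<beta> \<in> monos_upto (t - half_deg p)" and "\<gamma> \<in> monos_upto (t - half_deg p)"
  shows "localizing_mat p (dirac_moments t v) \<beta> \<gamma> =
    poly_eval p v * mono_eval v \<beta> * mono_eval v \<gamma>"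
proof -
  have "dirac_moments t v (\<alpha> + \<beta> + \<gamma>) = mono_eval v \<alpha> * mono_eval v \<beta> * mono_eval v \<gamma>"
    if "\<alpha> \<in> Poly_Mapping.keys p" for \<alpha>
  proof -
    have "mono_deg (\<alpha> + \<beta> + \<gamma>) \<le> 2 * half_deg p + (t - half_deg p) + (t - half_deg p)"
      using mono_deg_le_half_deg[OF that] assms(2,3) by (simp add: mono_deg_add monos_upto_def)
    with assms(1) show ?thesis
      by (simp add: dirac_moments_eq mono_eval_add)
  qed
  then show ?thesis
    by (simp add: localizing_mat_def poly_eval_def sum_distrib_right mult.assoc)
qed

lemma psd_moment_mat_dirac_moments:
  "psd_mat (monos_upto t) (moment_mat (dirac_moments t (v :: real ^ 'n::finite)))"
proof -
  let ?A = "monos_upto t :: 'n mono set"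
  have entry: "moment_mat (dirac_moments t v) \<alpha> \<beta> = mono_eval v \<alpha> * mono_eval v \<beta>"
    if "\<alpha> \<in> ?A" "\<beta> \<in> ?A" for \<alpha> \<beta>
    using that by (simp add: moment_mat_def dirac_moments_eq monos_upto_def mono_deg_add mono_eval_add)
  have "0 \<le> (\<Sum>\<alpha>\<in>?A. \<Sum>\<beta>\<in>?A. c \<alpha> * moment_mat (dirac_moments t v) \<alpha> \<beta> * c \<beta>)" for c
  proof -
    have "(\<Sum>\<alpha>\<in>?A. \<Sum>\<beta>\<in>?A. c \<alpha> * moment_mat (dirac_moments t v) \<alpha> \<beta> * c \<beta>) =
      (\<Sum>\<alpha>\<in>?A. \<Sum>\<beta>\<in>?A. (c \<alpha> * mono_eval v \<alpha>) * (c \<beta> * mono_eval v \<beta>))"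
      by (intro sum.cong refl) (simp add: entry)
    also have "\<dots> = (\<Sum>\<alpha>\<in>?A. c \<alpha> * mono_eval v \<alpha>)\<^sup>2"
      by (simp add: power2_eq_square sum_product)
    finally show ?thesis by simp
  qed
  then show ?thesis
    by (simp add: psd_mat_def entry)
qed

text \<open>
  The value of a generator at \<open>v\<close> is the entry \<open>\<beta> = \<gamma> = 0\<close> of its localizing matrix, and a
  factor of all other entries. So the localizing constraints say that \<open>v\<close> is a root, whereas
  the other constraints hold at every point.
\<close>

lemma dirac_moments_feasible_iff:
  assumes "t \<ge> max_half_deg m g"
  shows "dirac_moments t v \<in> moment_feasible t m g \<longleftrightarrow> v \<in> real_variety (ideal_gen m g)"
proof -
  have "half_deg (g j) \<le> t" if "j \<in> {1..m}" for j
  proof -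
    have "half_deg (g j) \<le> max_half_deg m g"
      unfolding max_half_deg_def using that by (intro Max_ge) auto
    with assms show ?thesis by simp
  qed
  note entry = localizing_mat_dirac_moments[OF this]
  have "(\<forall>\<beta>\<in>monos_upto (t - half_deg (g j)). \<forall>\<gamma>\<in>monos_upto (t - half_deg (g j)).
      localizing_mat (g j) (dirac_moments t v) \<beta> \<gamma> = 0) \<longleftrightarrow> poly_eval (g j) v = 0"
    if "j \<in> {1..m}" for j
  proof
    assume "\<forall>\<beta>\<in>monos_upto (t - half_deg (g j)). \<forall>\<gamma>\<in>monos_upto (t - half_deg (g j)).
      localizing_mat (g j) (dirac_moments t v) \<beta> \<gamma> = 0"
    then have "localizing_mat (g j) (dirac_moments t v) 0 0 = 0"
      by simp
    then show "poly_eval (g j) v = 0"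
      using entry[OF that, of 0 0 v] by simp
  qed (simp add: entry[OF that])
  moreover have "dirac_moments t v \<in> monos_upto (2 * t) \<rightarrow>\<^sub>E UNIV"
    by (simp add: dirac_moments_def)
  moreover have "dirac_moments t v 0 = 1"
    by (simp add: dirac_moments_eq)
  ultimately show ?thesis
    using psd_moment_mat_dirac_moments[of t v]
    by (auto simp: moment_feasible_def real_variety_ideal_gen)
qed

section \<open>The rank minimizers are the moments of the real roots\<close>

text \<open>A real root is needed for the minimal rank to be attained at the value \<open>1\<close>.\<close>

lemma rank_minimizers_eq_rank_1:
  assumes "real_variety (ideal_gen m g) \<noteq> {}" and "t \<ge> max_half_deg m g"
  shows "rank_minimizers t m g = {y \<in> moment_feasible t m g. moment_rank t y = 1}"
proof -
  from assms obtain v where v: "dirac_moments t v \<in> moment_feasible t m g"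
    using dirac_moments_feasible_iff by blast
  have ge_1: "1 \<le> moment_rank t y" if "y \<in> moment_feasible t m g" for y
    using that by (intro moment_rank_ge_1) (simp add: moment_feasible_def)
  have "moment_rank t y = 1" if "y \<in> rank_minimizers t m g" for y
  proof -
    have "y \<in> moment_feasible t m g" and "\<not> moment_rank t (dirac_moments t v) < moment_rank t y"
      using that v by (auto simp: rank_minimizers_def is_arg_min_def)
    with ge_1[of y] show ?thesis
      by (simp add: moment_rank_dirac_moments)
  qed
  moreover have "y \<in> rank_minimizers t m g"
    if "y \<in> moment_feasible t m g" "moment_rank t y = 1" for y
    using that ge_1 by (simp add: rank_minimizers_def is_arg_min_def not_less)
  moreover have "rank_minimizers t m g \<subseteq> moment_feasible t m g"
    by (auto simp: rank_minimizers_def is_arg_min_def)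
  ultimately show ?thesis
    by blast
qed

theorem theorem3:
  fixes m t :: nat
    and g :: "nat \<Rightarrow> 'n::finite rpoly"
    and I :: "'n rpoly set"
  assumes "I = ideal_gen m g"
    and "real_variety I \<noteq> {}"
    and "t \<ge> 1"
    and "t \<ge> max_half_deg m g"
  shows "bij_betw (dirac_moments t) (real_variety I) (rank_minimizers t m g) \<and>
         (\<forall>y\<in>rank_minimizers t m g. moment_rank t y = 1)"
proof -
  have minimizers: "rank_minimizers t m g = {y \<in> moment_feasible t m g. moment_rank t y = 1}"
    using assms rank_minimizers_eq_rank_1 by blast
  have "dirac_moments t ` real_variety I = rank_minimizers t m g"
  proof
    show "dirac_moments t ` real_variety I \<subseteq> rank_minimizers t m g"
      using assms(1,4) by (auto simp: minimizers moment_rank_dirac_moments dirac_moments_feasible_iff)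
    show "rank_minimizers t m g \<subseteq> dirac_moments t ` real_variety I"
    proof
      fix y assume y: "y \<in> rank_minimizers t m g"
      then obtain v where "y = dirac_moments t v"
        using rank_1_imp_dirac_moments[OF assms(3), of y]
        by (auto simp: minimizers moment_feasible_def)
      with y show "y \<in> dirac_moments t ` real_variety I"
        using assms(1,4) by (auto simp: minimizers dirac_moments_feasible_iff)
    qed
  qed
  then show ?thesis
    using inj_on_subset[OF inj_dirac_moments[OF assms(3)] subset_UNIV]
    by (auto simp: bij_betw_def minimizers)
qed

end
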